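(* Let $X$ be a Banach space such that $X^*$ is $C$-convex, and let $S=(X;X_k,k\geqslant 1)$ be an absolutely representing system of subspaces in $X$. Then there exists $N_0\in\mathbb{N}$ such that for every finite (nonempty) set $I\subset\mathbb{N}$ with $\min(I)\geqslant N_0$ the system of subspaces $X_k$, $k\notin I$, is an absolutely representing system of subspaces in $X$.
   Context: $X$ is a Banach space over $\mathbb{K}$ ($=\mathbb{R}$ or $\mathbb{C}$), $X^*$ is its dual, $\mathbb{N}=\{1,2,\ldots\}$; $\min(I)$ is the smallest element of $I$. For $J\subset\mathbb{N}$, a system of closed linear subspaces $X_k$, $k\in J$, of $X$ is an absolutely representing system of subspaces in $X$ if every $x\in X$ can be written as $x=\sum_{k\in J}x_k$ with $x_k\in X_k$ and $\sum_{k\in J}\|x_k\|<\infty$; for $S=(X;X_k,k\geqslant 1)$ take $J=\mathbb{N}$. A Banach space $Y$ over $\mathbb{K}$ is called $C$-convex if $c_0(\mathbb{K})$ is not finitely representable in $Y$, where $c_0(\mathbb{K})$ is the space of sequences in $\mathbb{K}$ tending to $0$ with the sup norm. Here a Banach space $E$ is finitely representable in $Y$ if for every finite-dimensional subspace $F\subset E$ and every $\eta>0$ there is an injective linear map $T:F\to Y$ with $\|T\|\,\|T^{-1}|_{T(F)}\|\leqslant 1+\eta$. *)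

theory Defs
  imports "HOL-Analysis.Analysis"
begin

text \<open>
  A normed space over \<open>\<real>\<close> or \<open>\<complex>\<close> is a type of class \<open>real_normed_vector\<close> together with a scalar
  multiplication by \<open>'k\<close> that restricts to \<open>scaleR\<close> and makes the norm absolutely homogeneous.
  Only \<open>'k = real\<close> (where \<open>smul = scaleR\<close> is forced) and \<open>'k = complex\<close> are intended.
\<close>

locale normed_space_over = vector_space smul
  for smul :: "'k::real_normed_field \<Rightarrow> 'a::real_normed_vector \<Rightarrow> 'a" +
  assumes norm_scale: "norm (smul c x) = norm c * norm x"
    and scale_of_real: "smul (of_real r) x = r *\<^sub>R x"

lemma normed_space_over_scaleR:
  "normed_space_over (scaleR :: real \<Rightarrow> 'a::real_normed_vector \<Rightarrow> 'a)"
  by unfold_locales (auto simp: algebra_simps)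

subsection \<open>The dual space\<close>

text \<open>
  The norm of \<open>'a \<Rightarrow>\<^sub>L 'k\<close> is the operator norm, which does not depend on whether the scalars
  are \<open>\<real>\<close> or \<open>'k\<close>.
\<close>

definition dual_space ::
    "('k::real_normed_field \<Rightarrow> 'a::real_normed_vector \<Rightarrow> 'a) \<Rightarrow> ('a \<Rightarrow>\<^sub>L 'k) set" where
  "dual_space smul = {f. \<forall>c x. blinfun_apply f (smul c x) = c * blinfun_apply f x}"

definition dual_scale ::
    "'k::real_normed_field \<Rightarrow> ('a::real_normed_vector \<Rightarrow>\<^sub>L 'k) \<Rightarrow> ('a \<Rightarrow>\<^sub>L 'k)" where
  "dual_scale c f = blinfun_mult_right c o\<^sub>L f"

lemma blinfun_apply_dual_scale [simp]:
  "blinfun_apply (dual_scale c f) x = c * blinfun_apply f x"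
  by (simp add: dual_scale_def)

lemma normed_space_over_dual_scale:
  "normed_space_over
    (dual_scale :: 'k::real_normed_field \<Rightarrow> ('a::real_normed_vector \<Rightarrow>\<^sub>L 'k) \<Rightarrow> _)"
proof
  fix c d :: 'k and f g :: "'a \<Rightarrow>\<^sub>L 'k" and r :: real
  show "dual_scale c (f + g) = dual_scale c f + dual_scale c g"
    "dual_scale (c + d) f = dual_scale c f + dual_scale d f"
    "dual_scale c (dual_scale d f) = dual_scale (c * d) f"
    "dual_scale 1 f = f"
    by (rule blinfun_eqI; simp add: blinfun.bilinear_simps algebra_simps)+
  show "dual_scale (of_real r) f = r *\<^sub>R f"
    by (rule blinfun_eqI) (simp add: blinfun.bilinear_simps scaleR_conv_of_real)
  have le: "norm (dual_scale c f) \<le> norm c * norm f" for c and f :: "'a \<Rightarrow>\<^sub>L 'k"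
    by (rule norm_blinfun_bound)
      (auto simp: norm_mult mult.assoc intro!: mult_left_mono norm_blinfun)
  show "norm (dual_scale c f) = norm c * norm f"
  proof (cases "c = 0")
    case False
    have "f = dual_scale (inverse c) (dual_scale c f)"
      by (rule blinfun_eqI) (simp add: False)
    then have "norm f \<le> norm (inverse c) * norm (dual_scale c f)"
      using le by metis
    then have "norm c * norm f \<le> norm (dual_scale c f)"
      using False by (simp add: norm_divide field_simps)
    with le show ?thesis by (rule antisym)
  qed (use le[of c f] in simp)
qed

lemma subspace_dual_space:
  assumes "normed_space_over smul"
  shows "module.subspace dual_scale (dual_space smul)"
proof -
  interpret D: normed_space_over dual_scale by (rule normed_space_over_dual_scale)
  show ?thesis
    by (auto simp: D.subspace_def dual_space_def blinfun.bilinear_simps algebra_simps)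
qed

subsection \<open>The space \<open>c\<^sub>0\<close>\<close>

text \<open>
  Bounded sequences are the bounded continuous functions on the discrete space \<open>nat\<close>; the norm
  of that type is the supremum norm. Indexing starts at 0.
\<close>

definition c0_space :: "(nat \<Rightarrow>\<^sub>C 'k::real_normed_field) set" where
  "c0_space = {f. apply_bcontfun f \<longlonglongrightarrow> 0}"

definition bseq_scale :: "'k::real_normed_field \<Rightarrow> (nat \<Rightarrow>\<^sub>C 'k) \<Rightarrow> (nat \<Rightarrow>\<^sub>C 'k)" where
  "bseq_scale c f = Bcontfun (\<lambda>n. c * apply_bcontfun f n)"

lemma apply_bseq_scale [simp]:
  "apply_bcontfun (bseq_scale c f) n = c * apply_bcontfun f n"
proof -
  have "bounded (range (\<lambda>n. c * apply_bcontfun f n))"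
    unfolding bounded_iff
    by (auto simp: norm_mult intro!: exI[of _ "norm c * norm f"] mult_left_mono norm_bounded)
  then have "(\<lambda>n. c * apply_bcontfun f n) \<in> bcontfun"
    by (simp add: bcontfun_def)
  then show ?thesis
    by (simp add: bseq_scale_def Bcontfun_inverse)
qed

lemma normed_space_over_bseq_scale:
  "normed_space_over (bseq_scale :: 'k::real_normed_field \<Rightarrow> _)"
proof
  fix c d :: 'k and f g :: "nat \<Rightarrow>\<^sub>C 'k" and r :: real
  show "bseq_scale c (f + g) = bseq_scale c f + bseq_scale c g"
    "bseq_scale (c + d) f = bseq_scale c f + bseq_scale d f"
    "bseq_scale c (bseq_scale d f) = bseq_scale (c * d) f"
    "bseq_scale 1 f = f"
    by (rule bcontfun_eqI; simp add: algebra_simps)+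
  show "bseq_scale (of_real r) f = r *\<^sub>R f"
    by (rule bcontfun_eqI) (simp add: scaleR_conv_of_real)
  have le: "norm (bseq_scale c f) \<le> norm c * norm f" for c and f :: "nat \<Rightarrow>\<^sub>C 'k"
    by (rule norm_bound) (auto simp: norm_mult intro!: mult_left_mono norm_bounded)
  show "norm (bseq_scale c f) = norm c * norm f"
  proof (cases "c = 0")
    case False
    have "f = bseq_scale (inverse c) (bseq_scale c f)"
      by (rule bcontfun_eqI) (simp add: False)
    then have "norm f \<le> norm (inverse c) * norm (bseq_scale c f)"
      using le by metis
    then have "norm c * norm f \<le> norm (bseq_scale c f)"
      using False by (simp add: norm_divide field_simps)
    with le show ?thesis by (rule antisym)
  qed (use le[of c f] in simp)
qed

lemma subspace_c0_space: "module.subspace bseq_scale (c0_space :: (nat \<Rightarrow>\<^sub>C 'k::real_normed_field) set)"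
proof -
  interpret B: normed_space_over "bseq_scale :: 'k \<Rightarrow> _" by (rule normed_space_over_bseq_scale)
  have *: "apply_bcontfun (bseq_scale c f) = (\<lambda>n. c * apply_bcontfun f n)"
    for c :: 'k and f by auto
  show ?thesis
    by (auto simp: B.subspace_def c0_space_def * plus_bcontfun.rep_eq zero_bcontfun.rep_eq
        intro: tendsto_add_zero tendsto_mult_right_zero)
qed

subsection \<open>Finite representability and \<open>C\<close>-convexity\<close>

definition linear_map_on ::
    "('k::field \<Rightarrow> 'e::ab_group_add \<Rightarrow> 'e) \<Rightarrow> ('k \<Rightarrow> 'y::ab_group_add \<Rightarrow> 'y) \<Rightarrow> 'e set \<Rightarrow> ('e \<Rightarrow> 'y) \<Rightarrow> bool"
  where
  "linear_map_on sE sY F T \<longleftrightarrow>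
    (\<forall>u\<in>F. \<forall>v\<in>F. T (u + v) = T u + T v) \<and> (\<forall>c. \<forall>u\<in>F. T (sE c u) = sY c (T u))"

text \<open>
  The relativisation of \<open>onorm\<close> to a subspace. As for \<open>onorm\<close>, the supremum is meaningful only for
  bounded maps; below it is applied only to linear maps on finite-dimensional subspaces.
\<close>

definition onorm_on ::
    "'e::real_normed_vector set \<Rightarrow> ('e \<Rightarrow> 'y::real_normed_vector) \<Rightarrow> real" where
  "onorm_on F T = (SUP u\<in>F. norm (T u) / norm u)"

definition finite_dim_subspace ::
    "('k::field \<Rightarrow> 'e::ab_group_add \<Rightarrow> 'e) \<Rightarrow> 'e set \<Rightarrow> bool" where
  "finite_dim_subspace smul F \<longleftrightarrow> (\<exists>B. finite B \<and> F = module.span smul B)"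

text \<open>The spaces \<open>E\<close> and \<open>Y\<close> are given as subspaces of normed spaces with scalar
  multiplications \<open>sE\<close> and \<open>sY\<close>.\<close>

definition finitely_representable ::
    "('k::real_normed_field \<Rightarrow> 'e::real_normed_vector \<Rightarrow> 'e) \<Rightarrow> 'e set \<Rightarrow>
     ('k \<Rightarrow> 'y::real_normed_vector \<Rightarrow> 'y) \<Rightarrow> 'y set \<Rightarrow> bool" where
  "finitely_representable sE E sY Y \<longleftrightarrow>
    (\<forall>F \<eta>. F \<subseteq> E \<and> finite_dim_subspace sE F \<and> \<eta> > 0 \<longrightarrow>
      (\<exists>T. T ` F \<subseteq> Y \<and> linear_map_on sE sY F T \<and> inj_on T F \<and>
        onorm_on F T * onorm_on (T ` F) (inv_into F T) \<le> 1 + \<eta>))"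

definition C_convex ::
    "('k::real_normed_field \<Rightarrow> 'y::real_normed_vector \<Rightarrow> 'y) \<Rightarrow> 'y set \<Rightarrow> bool" where
  "C_convex sY Y \<longleftrightarrow> \<not> finitely_representable bseq_scale c0_space sY Y"

subsection \<open>Absolutely representing systems of subspaces\<close>

definition abs_representing_system ::
    "('k::real_normed_field \<Rightarrow> 'a::real_normed_vector \<Rightarrow> 'a) \<Rightarrow> nat set \<Rightarrow> (nat \<Rightarrow> 'a set) \<Rightarrow> bool"
  where
  "abs_representing_system smul J V \<longleftrightarrow>
    (\<forall>k\<in>J. module.subspace smul (V k) \<and> closed (V k)) \<and>
    (\<forall>x. \<exists>u. (\<forall>k\<in>J. u k \<in> V k) \<and> (\<lambda>k. norm (u k)) summable_on J \<and> (u has_sum x) J)"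

end

theory Submission
  imports Defs
begin

text \<open>
  A family of closed subspaces \<open>V k\<close>, \<open>k \<in> J\<close>, of a Banach space is an absolutely representing
  system if and only if it is norming for the dual: there is a constant \<open>C\<close> such that every
  functional \<open>f\<close> with \<open>\<bar>f v\<bar> \<le> \<parallel>v\<parallel>\<close> for all \<open>v \<in> V k\<close>, \<open>k \<in> J\<close>, has norm at most \<open>C\<close>.
  The necessity of this condition (\<open>norming_constant_exists\<close>) is uniform boundedness. For the
  sufficiency (\<open>abs_representing_system_if_norming\<close>) consider the seminorm
  \<open>p x = inf (a + 2 C \<parallel>x - y\<parallel>)\<close>, the infimum being over all \<open>y\<close> that have an absolutely convergent
  expansion of total norm at most \<open>a\<close>. A Hahn-Banach functional for \<open>p\<close> at \<open>x\<close> has norm at most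
  \<open>C\<close>, so \<open>p x \<le> C \<parallel>x\<parallel>\<close>. Hence \<open>x\<close> can be approximated up to \<open>3/4 \<parallel>x\<parallel>\<close> by such a \<open>y\<close> with
  \<open>a \<le> 3/2 C \<parallel>x\<parallel>\<close>, and iterating the approximation expands \<open>x\<close>.

  Suppose now that no \<open>N0\<close> works. Then there are pairwise disjoint finite sets \<open>I j\<close> such that the
  subspaces with indices outside \<open>I j\<close> do not form an absolutely representing system, and thus
  functionals \<open>f j\<close> of norm 1 that are bounded by \<open>2 ^ -(j + 1)\<close> on the unit ball of \<open>V k\<close> for every
  \<open>k \<notin> I j\<close> (\<open>almost_vanishing_functional\<close>). As each \<open>k\<close> lies in at most one \<open>I j\<close>, every finite
  sum \<open>\<Sum> a j f j\<close> with \<open>\<bar>a j\<bar> \<le> 1\<close> is bounded by 2 on the unit ball of each \<open>V k\<close>, and so its norm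
  is at most \<open>2 C\<close> (\<open>unit_sums_bounded_if_almost_disjoint\<close>).

  A sequence of vectors of norm at least 1 with bounded sums of this kind forces \<open>c\<^sub>0\<close> to be finitely
  representable (\<open>c0_finitely_representable\<close>), by James's distortion argument. Let \<open>K\<close> be the limit
  of the suprema of the norms of the sums supported on \<open>[n, \<infinity>)\<close>. Far out there are successive
  blocks \<open>z i\<close> with \<open>\<parallel>z i\<parallel> \<ge> K (1 - \<delta>)\<close>, while all their sums with coefficients in the unit ball
  have norm at most \<open>K (1 + \<delta>)\<close>. Changing all signs but one in a sum turns the upper bound into a
  lower bound, so \<open>b \<mapsto> \<Sum> b i z i\<close> is almost a multiple of an isometry on all of \<open>c\<^sub>0\<close>. Applied to
  \<open>f j\<close>, this contradicts the \<open>C\<close>-convexity of the dual.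
\<close>

section \<open>The Hahn-Banach theorem\<close>

text \<open>Positive homogeneity includes the factor 0, so that \<open>q 0 = 0\<close>.\<close>

definition sublinear :: "('a::real_vector \<Rightarrow> real) \<Rightarrow> bool" where
  "sublinear q \<longleftrightarrow> (\<forall>x y. q (x + y) \<le> q x + q y) \<and> (\<forall>c\<ge>0. \<forall>x. q (c *\<^sub>R x) = c * q x)"

lemma sublinearI:
  assumes add: "\<And>x y. q (x + y) \<le> q x + q y" and zero: "q 0 = 0"
    and scale: "\<And>c x. c > 0 \<Longrightarrow> q (c *\<^sub>R x) \<le> c * q x"
  shows "sublinear q"
  unfolding sublinear_def
proof (intro conjI allI impI)
  fix c :: real and x assume "c \<ge> 0"
  show "q (c *\<^sub>R x) = c * q x"
  proof (cases "c = 0")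
    case False
    with \<open>c \<ge> 0\<close> have c: "c > 0" by simp
    have "q (inverse c *\<^sub>R (c *\<^sub>R x)) \<le> inverse c * q (c *\<^sub>R x)"
      using c by (intro scale) simp
    then have "c * q x \<le> q (c *\<^sub>R x)"
      using c by (simp add: field_simps)
    then show ?thesis using scale[OF c, of x] by simp
  qed (simp add: zero)
qed (rule add)

lemma sublinear_add: "sublinear q \<Longrightarrow> q (x + y) \<le> q x + q y"
  and sublinear_scale: "sublinear q \<Longrightarrow> c \<ge> 0 \<Longrightarrow> q (c *\<^sub>R x) = c * q x"
  and sublinear_zero: "sublinear q \<Longrightarrow> q 0 = 0"
  unfolding sublinear_def by (blast, blast, metis order_refl scaleR_zero_left mult_zero_left)

lemma sublinear_minus: "sublinear q \<Longrightarrow> - q (- x) \<le> q x"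
  using sublinear_add[of q x "- x"] sublinear_zero[of q] by simp

text \<open>
  A sublinear functional can be lowered so as to become at most \<open>- q y\<close> at \<open>- y\<close>. Applied to a
  minimal functional, this makes it odd; applied to \<open>p\<close> and \<open>x0\<close>, it forces every linear functional
  below the result to agree with \<open>p\<close> at \<open>x0\<close>.
\<close>
lemma sublinear_tilt:
  assumes q: "sublinear q"
  obtains r where "sublinear r" "r \<le> q" "r (- y) \<le> - q y"
proof -
  define h where "h x t = q (x + t *\<^sub>R y) - t * q y" for x t
  define r where "r x = (INF t\<in>{0..}. h x t)" for x
  have low: "- q (- x) \<le> h x t" if "t \<ge> 0" for x t
    using sublinear_add[OF q, of "x + t *\<^sub>R y" "- x"] sublinear_scale[OF q that, of y]
    by (simp add: h_def)
  have r_le: "r x \<le> h x t" if "t \<ge> 0" for x t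
    unfolding r_def using that low by (intro cINF_lower bdd_belowI2[of _ "- q (- x)"]) auto
  have r_greatest: "b \<le> r x" if "\<And>t. t \<ge> 0 \<Longrightarrow> b \<le> h x t" for b x
    unfolding r_def using that by (intro cINF_greatest) auto
  have "sublinear r"
  proof (rule sublinearI)
    fix x x'
    have "r (x + x') - h x t \<le> r x'" if "t \<ge> 0" for t
    proof (rule r_greatest)
      fix t' :: real assume t': "t' \<ge> 0"
      have "r (x + x') \<le> h (x + x') (t + t')" using that t' by (intro r_le) simp
      also have "\<dots> \<le> h x t + h x' t'"
        using sublinear_add[OF q, of "x + t *\<^sub>R y" "x' + t' *\<^sub>R y"]
        by (simp add: h_def algebra_simps)
      finally show "r (x + x') - h x t \<le> h x' t'" by simp
    qed
    then have "r (x + x') - r x' \<le> r x"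
      by (intro r_greatest) (simp add: algebra_simps)
    then show "r (x + x') \<le> r x + r x'" by simp
  next
    have "0 \<le> r 0"
      by (rule r_greatest) (simp add: h_def sublinear_scale[OF q])
    moreover have "r 0 \<le> 0" using r_le[of 0 0] by (simp add: h_def sublinear_zero[OF q])
    ultimately show "r 0 = 0" by simp
  next
    fix c :: real and x assume c: "c > 0"
    have "inverse c * r (c *\<^sub>R x) \<le> r x"
    proof (rule r_greatest)
      fix t :: real assume t: "t \<ge> 0"
      have "r (c *\<^sub>R x) \<le> h (c *\<^sub>R x) (c * t)" using c t by (intro r_le) simp
      also have "\<dots> = c * h x t"
        using sublinear_scale[OF q, of c "x + t *\<^sub>R y"] c by (simp add: h_def algebra_simps)
      finally show "inverse c * r (c *\<^sub>R x) \<le> h x t" using c by (simp add: field_simps)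
    qed
    then show "r (c *\<^sub>R x) \<le> c * r x" using c by (simp add: field_simps)
  qed
  moreover have "r \<le> q"
    using r_le[of 0] by (auto simp: le_fun_def h_def)
  moreover have "r (- y) \<le> - q y"
    using r_le[of 1 "- y"] by (simp add: h_def sublinear_zero[OF q])
  ultimately show ?thesis by (rule that)
qed

text \<open>By Zorn's lemma: the pointwise infimum of a chain is sublinear, and finite because every member
  is bounded below by \<open>- p (- x)\<close>.\<close>
lemma minimal_sublinear:
  assumes p: "sublinear p"
  obtains m where "sublinear m" "m \<le> p" "\<And>q. sublinear q \<Longrightarrow> q \<le> m \<Longrightarrow> q = m"
proof -
  define A where "A = {q. sublinear q \<and> q \<le> p}"
  have "\<exists>m\<in>A. \<forall>q\<in>A. m \<ge> q \<longrightarrow> q = m"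
  proof (rule predicate_Zorn)
    show "partial_order_on A (relation_of (\<ge>) A)"
      by (auto simp: partial_order_on_def preorder_on_def refl_on_def trans_def antisym_def
          relation_of_def)
  next
    fix C assume "C \<in> Chains (relation_of (\<ge>) A)"
    then have CA: "C \<subseteq> A" and chain: "\<And>q q'. q \<in> C \<Longrightarrow> q' \<in> C \<Longrightarrow> q \<le> q' \<or> q' \<le> q"
      by (auto simp: Chains_def relation_of_def)
    show "\<exists>u\<in>A. \<forall>a\<in>C. a \<ge> u"
    proof (cases "C = {}")
      case True
      then show ?thesis using p by (auto simp: A_def)
    next
      case False
      define u where "u x = (INF q\<in>C. q x)" for x
      have sub: "sublinear q" and le: "q x \<le> p x" if "q \<in> C" for q x
        using that CA by (auto simp: A_def le_fun_def)
      have low: "- p (- x) \<le> q x" if "q \<in> C" for q x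
        using sublinear_minus[OF sub[OF that], of x] le[OF that, of "- x"] by simp
      have u_le: "u x \<le> q x" if "q \<in> C" for q x
        unfolding u_def using that low by (intro cINF_lower bdd_belowI2[of _ "- p (- x)"]) auto
      have u_greatest: "b \<le> u x" if "\<And>q. q \<in> C \<Longrightarrow> b \<le> q x" for b x
        unfolding u_def using that False by (intro cINF_greatest) auto
      obtain q where q: "q \<in> C" using False by blast
      have "sublinear u"
      proof (rule sublinearI)
        fix x y
        have "u (x + y) - q x \<le> u y" if q: "q \<in> C" for q
        proof (rule u_greatest)
          fix q' assume q': "q' \<in> C"
          obtain q'' where "q'' \<in> C" "q'' \<le> q" "q'' \<le> q'"
            using chain[OF q q'] q q' by blast
          then have "u (x + y) \<le> q'' x + q'' y" "q'' x \<le> q x" "q'' y \<le> q' y"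
            using u_le[of q'' "x + y"] sublinear_add[OF sub, of q'' x y]
            by (auto simp: le_fun_def)
          then show "u (x + y) - q x \<le> q' y" by simp
        qed
        then have "u (x + y) - u y \<le> u x"
          by (intro u_greatest) (simp add: algebra_simps)
        then show "u (x + y) \<le> u x + u y" by simp
      next
        show "u 0 = 0"
        proof (rule antisym)
          show "u 0 \<le> 0" using u_le[OF q, of 0] sublinear_zero[OF sub[OF q]] by simp
          show "0 \<le> u 0" by (rule u_greatest) (metis order_refl sublinear_zero sub)
        qed
      next
        fix c :: real and x assume c: "c > 0"
        have "inverse c * u (c *\<^sub>R x) \<le> u x"
        proof (rule u_greatest)
          fix q assume q: "q \<in> C"
          have "u (c *\<^sub>R x) \<le> c * q x"
            using u_le[OF q, of "c *\<^sub>R x"] sublinear_scale[OF sub[OF q], of c x] c by simp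
          then show "inverse c * u (c *\<^sub>R x) \<le> q x" using c by (simp add: field_simps)
        qed
        then show "u (c *\<^sub>R x) \<le> c * u x" using c by (simp add: field_simps)
      qed
      moreover have "u \<le> p"
        using order_trans[OF u_le[OF q] le[OF q]] by (rule le_funI)
      ultimately show ?thesis
        using u_le by (auto simp: A_def le_fun_def)
    qed
  qed
  then obtain m where "m \<in> A" and "\<And>q. q \<in> A \<Longrightarrow> q \<le> m \<Longrightarrow> q = m" by blast
  then show ?thesis
    by (intro that[of m]) (auto simp: A_def intro: order_trans)
qed

text \<open>A minimal sublinear functional is linear.\<close>
theorem hahn_banach_sublinear:
  assumes p: "sublinear p"
  obtains g where "linear g" "\<And>x. g x \<le> p x" "g x0 = p x0"
proof -
  obtain q where q: "sublinear q" "q \<le> p" "q (- x0) \<le> - p x0"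
    using sublinear_tilt[OF p] by blast
  obtain m where m: "sublinear m" "m \<le> q" "\<And>r. sublinear r \<Longrightarrow> r \<le> m \<Longrightarrow> r = m"
    using minimal_sublinear[OF q(1)] by blast
  have minus: "m (- y) = - m y" for y
  proof -
    obtain r where "sublinear r" "r \<le> m" "r (- y) \<le> - m y"
      using sublinear_tilt[OF m(1)] by blast
    with m(3)[of r] show ?thesis using sublinear_minus[OF m(1), of y] by simp
  qed
  have "linear m"
  proof (rule linearI)
    fix x y
    show "m (x + y) = m x + m y"
      using sublinear_add[OF m(1), of x y] sublinear_add[OF m(1), of "x + y" "- y"] minus[of y]
      by simp
  next
    fix c x
    show "m (c *\<^sub>R x) = c *\<^sub>R m x"
      using sublinear_scale[OF m(1), of c x] sublinear_scale[OF m(1), of "- c" x]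
        minus[of "c *\<^sub>R x"] by (cases "c \<ge> 0") auto
  qed
  moreover have le: "m x \<le> p x" for x
    using m(2) q(2) by (meson le_funD order_trans)
  moreover have "m x0 = p x0"
    using le[of x0] minus[of x0] q(3) le_funD[OF m(2), of "- x0"] by simp
  ultimately show ?thesis by (rule that)
qed

text \<open>
  Banach spaces in which the Hahn-Banach theorem holds for seminorms over the scalar field. The
  assumption is met for real and complex scalars; stating it as a locale lets the rest of the
  argument treat both cases at once. The bound \<open>M\<close> makes the functional continuous.
\<close>
locale hahn_banach_space = normed_space_over smul
  for smul :: "'k::{real_normed_field,banach} \<Rightarrow> 'a::banach \<Rightarrow> 'a" +
  assumes hahn_banach: "\<And>p M x0. \<lbrakk>\<And>x y. p (x + y) \<le> p x + p y; \<And>c x. p (smul c x) = norm c * p x;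
      \<And>x. p x \<le> M * norm x\<rbrakk> \<Longrightarrow>
      \<exists>f\<in>dual_space smul. (\<forall>x. norm (blinfun_apply f x) \<le> p x) \<and> norm (blinfun_apply f x0) = p x0"

lemma (in normed_space_over) bounded_linear_smul: "bounded_linear (smul c)"
  by (intro bounded_linear_intro[of _ "norm c"])
    (auto simp: norm_scale scale_right_distrib scale_of_real[symmetric] mult.commute)

lemma (in normed_space_over) seminorm_sublinear:
  assumes "\<And>x y. p (x + y) \<le> p x + p y" "\<And>c x. p (smul c x) = norm c * p x"
  shows "sublinear p" "p (- x) = p x" "p x \<ge> 0"
proof -
  have s: "p (c *\<^sub>R x) = \<bar>c\<bar> * p x" for c x
    using assms(2)[of "of_real c" x] by (simp add: scale_of_real)
  then show "sublinear p" using assms(1) by (auto simp: sublinear_def)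
  show m: "p (- x) = p x" using s[of "-1" x] by simp
  show "p x \<ge> 0" using assms(1)[of x "- x"] s[of 0 0] m by simp
qed

lemma hahn_banach_space_real:
  "hahn_banach_space (scaleR :: real \<Rightarrow> 'a::banach \<Rightarrow> 'a)"
proof -
  interpret R: normed_space_over "scaleR :: real \<Rightarrow> 'a \<Rightarrow> 'a"
    by (rule normed_space_over_scaleR)
  show ?thesis
  proof unfold_locales
    fix p :: "'a \<Rightarrow> real" and M x0
    assume p: "\<And>x y. p (x + y) \<le> p x + p y" "\<And>c x. p (c *\<^sub>R x) = norm c * p x"
      and M: "\<And>x. p x \<le> M * norm x"
    note sn = R.seminorm_sublinear[OF p]
    obtain g where g: "linear g" "\<And>x. g x \<le> p x" "g x0 = p x0"
      using hahn_banach_sublinear[OF sn(1)] by blast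
    have abs: "norm (g x) \<le> p x" for x
      using g(2)[of x] g(2)[of "- x"] linear_neg[OF g(1), of x] sn(2)[of x] by simp
    have "bounded_linear g"
      using g(1) order_trans[OF abs M]
      by (intro bounded_linear_intro[of _ M])
        (auto simp: linear_add linear_cmul mult.commute)
    then show "\<exists>f\<in>dual_space scaleR. (\<forall>x. norm (blinfun_apply f x) \<le> p x) \<and>
        norm (blinfun_apply f x0) = p x0"
      using abs g sn(3)
      by (intro bexI[of _ "Blinfun g"])
        (auto simp: dual_space_def bounded_linear_Blinfun_apply linear_cmul)
  qed
qed

lemma hahn_banach_space_complex:
  fixes scaleC :: "complex \<Rightarrow> 'a::banach \<Rightarrow> 'a"
  assumes "normed_space_over scaleC"
  shows "hahn_banach_space scaleC"
proof -
  interpret C: normed_space_over scaleC by (rule assms)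
  show ?thesis
  proof unfold_locales
    fix p :: "'a \<Rightarrow> real" and M x0
    assume p: "\<And>x y. p (x + y) \<le> p x + p y" "\<And>c x. p (scaleC c x) = norm c * p x"
      and M: "\<And>x. p x \<le> M * norm x"
    note sn = C.seminorm_sublinear[OF p]
    obtain g where g: "linear g" "\<And>x. g x \<le> p x" "g x0 = p x0"
      using hahn_banach_sublinear[OF sn(1)] by blast
    have abs: "\<bar>g x\<bar> \<le> p x" for x
      using g(2)[of x] g(2)[of "- x"] linear_neg[OF g(1), of x] sn(2)[of x] by simp
    \<comment> \<open>the complex linear functional with real part \<open>g\<close>\<close>
    define f where "f x = Complex (g x) (- g (scaleC \<i> x))" for x
    have f_scaleR: "f (r *\<^sub>R x) = of_real r * f x" for r x
    proof -
      have "scaleC \<i> (r *\<^sub>R x) = r *\<^sub>R scaleC \<i> x"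
        using C.scale_of_real[symmetric] by (simp add: mult.commute)
      then show ?thesis by (simp add: f_def complex_eq_iff linear_cmul[OF g(1)])
    qed
    have f_add: "f (x + y) = f x + f y" for x y
      by (simp add: f_def complex_eq_iff linear_add[OF g(1)] C.scale_right_distrib)
    have f_i: "f (scaleC \<i> x) = \<i> * f x" for x
      by (simp add: f_def complex_eq_iff linear_neg[OF g(1)])
    have f_scale: "f (scaleC c x) = c * f x" for c x
    proof -
      have "scaleC c x = Re c *\<^sub>R x + Im c *\<^sub>R scaleC \<i> x"
        by (subst complex_eq[of c])
          (simp add: C.scale_left_distrib C.scale_of_real[symmetric] mult.commute)
      then have "f (scaleC c x) = (of_real (Re c) + \<i> * of_real (Im c)) * f x"
        by (simp only: f_add f_scaleR f_i) (simp add: algebra_simps)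
      then show ?thesis using complex_eq[of c] by simp
    qed
    have bound: "norm (f x) \<le> p x" for x
    proof -
      \<comment> \<open>rotate \<open>f x\<close> onto the nonnegative reals, where \<open>f\<close> coincides with \<open>g\<close>\<close>
      define c where "c = cnj (sgn (f x))"
      have "c * f x = of_real (norm (f x))"
        by (simp add: c_def sgn_eq complex_norm_square[symmetric] power2_eq_square mult.commute)
      then have "norm (f x) = g (scaleC c x)"
        using f_scale[of c x] by (simp add: f_def complex_eq_iff)
      also have "\<dots> \<le> norm c * p x" using g(2)[of "scaleC c x"] p(2)[of c x] by simp
      also have "\<dots> \<le> p x"
        using sn(3)[of x] by (simp add: c_def norm_sgn)
      finally show ?thesis .
    qed
    have "bounded_linear f"
      using order_trans[OF bound M]
      by (intro bounded_linear_intro[of _ M])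
        (auto simp: f_add f_scaleR mult.commute scaleR_conv_of_real)
    moreover have "p x0 \<le> norm (f x0)"
      using g(3) complex_Re_le_cmod[of "f x0"] by (simp add: f_def)
    ultimately show "\<exists>f\<in>dual_space scaleC. (\<forall>x. norm (blinfun_apply f x) \<le> p x) \<and>
        norm (blinfun_apply f x0) = p x0"
      using bound bound[of x0]
      by (intro bexI[of _ "Blinfun f"])
        (auto simp: dual_space_def bounded_linear_Blinfun_apply f_scale)
  qed
qed

section \<open>Absolutely representing systems and norming families\<close>

text \<open>
  \<open>x\<close> is the sum of an absolutely convergent series of vectors from \<open>V k\<close>, \<open>k \<in> J\<close>, whose norms add
  up to at most \<open>a\<close>.
\<close>
definition expansion_cost_le ::
    "nat set \<Rightarrow> (nat \<Rightarrow> 'a::real_normed_vector set) \<Rightarrow> 'a \<Rightarrow> real \<Rightarrow> bool" where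
  "expansion_cost_le J V x a \<longleftrightarrow>
    (\<exists>u s. (\<forall>k\<in>J. u k \<in> V k) \<and> ((\<lambda>k. norm (u k)) has_sum s) J \<and> s \<le> a \<and> (u has_sum x) J)"

lemma abs_representing_system_iff:
  "abs_representing_system smul J V \<longleftrightarrow>
    (\<forall>k\<in>J. module.subspace smul (V k) \<and> closed (V k)) \<and> (\<forall>x. \<exists>a. expansion_cost_le J V x a)"
  unfolding abs_representing_system_def expansion_cost_le_def summable_on_def by blast

lemma expansion_cost_le_norm:
  "expansion_cost_le J V x a \<Longrightarrow> norm x \<le> a"
  unfolding expansion_cost_le_def by (auto intro: order_trans[OF norm_infsum_le[OF _ _ order_refl]])

lemma expansion_cost_le_blinfun:
  fixes f :: "'a::real_normed_vector \<Rightarrow>\<^sub>L 'b::real_normed_vector"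
  assumes "expansion_cost_le J V x a" and "\<And>k v. k \<in> J \<Longrightarrow> v \<in> V k \<Longrightarrow> norm (f v) \<le> norm v"
  shows "norm (f x) \<le> a"
proof -
  obtain u s where u: "\<And>k. k \<in> J \<Longrightarrow> u k \<in> V k" "((\<lambda>k. norm (u k)) has_sum s) J" "s \<le> a"
    "(u has_sum x) J"
    using assms(1) unfolding expansion_cost_le_def by blast
  have "((\<lambda>k. f (u k)) has_sum f x) J"
    by (rule has_sum_bounded_linear[OF blinfun.bounded_linear_right u(4)])
  then have "norm (f x) \<le> s"
    by (rule norm_infsum_le[OF _ u(2)]) (use assms(2) u(1) in blast)
  then show ?thesis using u(3) by simp
qed

text \<open>The functionals in question are pointwise bounded by the cost of an expansion, hence uniformly
  bounded by Baire's theorem.\<close>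
lemma norming_constant_exists:
  fixes V :: "nat \<Rightarrow> 'a::banach set"
  assumes "\<And>x. \<exists>a. expansion_cost_le J V x a"
  shows "\<exists>C. \<forall>f :: 'a \<Rightarrow>\<^sub>L 'b::real_normed_vector.
    (\<forall>k\<in>J. \<forall>v\<in>V k. norm (blinfun_apply f v) \<le> norm v) \<longrightarrow> norm f \<le> C"
proof -
  define F where
    "F = {f :: 'a \<Rightarrow>\<^sub>L 'b. \<forall>k\<in>J. \<forall>v\<in>V k. norm (blinfun_apply f v) \<le> norm v}"
  define E where "E n = {x. \<forall>f\<in>F. norm (blinfun_apply f x) \<le> real n}" for n
  have closed: "closed (E n)" for n
  proof -
    have "E n = (\<Inter>f\<in>F. {x. norm (blinfun_apply f x) \<le> real n})"
      by (auto simp: E_def)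
    moreover have "closed {x. norm (blinfun_apply f x) \<le> real n}" for f :: "'a \<Rightarrow>\<^sub>L 'b"
      by (intro closed_Collect_le continuous_intros)
    ultimately show ?thesis by auto
  qed
  have cover: "x \<in> (\<Union>n. E n)" for x
  proof -
    obtain a where a: "expansion_cost_le J V x a" using assms by blast
    have "norm (blinfun_apply f x) \<le> a" if "f \<in> F" for f
      using that by (intro expansion_cost_le_blinfun[OF a]) (auto simp: F_def)
    then have "x \<in> E (nat \<lceil>a\<rceil>)"
      unfolding E_def using order_trans[OF _ real_nat_ceiling_ge] by blast
    then show ?thesis by blast
  qed
  have "\<exists>n. interior (E n) \<noteq> {}"
  proof (rule ccontr)
    assume *: "\<nexists>n. interior (E n) \<noteq> {}"
    have "euclidean interior_of (\<Union>(range E)) = {}"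
      by (rule Baire_category_alt)
        (use * closed in \<open>auto simp: completely_metrizable_space_euclidean\<close>)
    moreover have "\<Union>(range E) = UNIV" using cover by blast
    ultimately show False by simp
  qed
  then obtain n x0 where "x0 \<in> interior (E n)" by blast
  then obtain r where r: "r > 0" "cball x0 r \<subseteq> E n"
    by (metis mem_interior_cball)
  have "norm f \<le> 2 * real n / r" if f: "f \<in> F" for f
  proof (rule norm_blinfun_bound)
    fix x
    show "norm (blinfun_apply f x) \<le> 2 * real n / r * norm x"
    proof (cases "x = 0")
      case False
      define y where "y = (r / norm x) *\<^sub>R x"
      have "norm y = r" using False r(1) by (simp add: y_def)
      then have "x0 + y \<in> E n" "x0 \<in> E n"
        using r by (auto simp: subset_iff dist_norm)
      then have "norm (f (x0 + y)) \<le> n" "norm (f x0) \<le> n"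
        using f by (auto simp: E_def)
      moreover have "f y = f (x0 + y) - f x0" by (simp add: blinfun.add_right)
      ultimately have "norm (f y) \<le> 2 * real n"
        using norm_triangle_ineq4[of "f (x0 + y)" "f x0"] by simp
      then show ?thesis
        using False r(1) by (simp add: y_def blinfun.scaleR_right field_simps)
    qed simp
  qed (use r in simp)
  then show ?thesis
    by (intro exI[of _ "2 * real n / r"]) (auto simp: F_def)
qed

context normed_space_over
begin

context
  fixes J :: "nat set" and V :: "nat \<Rightarrow> 'a set"
  assumes sub: "\<And>k. k \<in> J \<Longrightarrow> subspace (V k)"
begin

lemma expansion_cost_le_zero: "expansion_cost_le J V 0 0"
  unfolding expansion_cost_le_def
  by (intro exI[of _ "\<lambda>_. 0"] exI[of _ 0]) (auto intro: subspace_0[OF sub])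

lemma expansion_cost_le_component:
  assumes "k \<in> J" "v \<in> V k"
  shows "expansion_cost_le J V v (norm v)"
  unfolding expansion_cost_le_def
  using assms subspace_0[OF sub]
  by (intro exI[of _ "\<lambda>j. if j = k then v else 0"] exI[of _ "norm v"])
    (auto intro!: has_sum_finite_neutralI[of "{k}"] split: if_splits)

lemma expansion_cost_le_add:
  assumes "expansion_cost_le J V x a" "expansion_cost_le J V y b"
  shows "expansion_cost_le J V (x + y) (a + b)"
proof -
  obtain u s where u: "\<And>k. k \<in> J \<Longrightarrow> u k \<in> V k" "((\<lambda>k. norm (u k)) has_sum s) J" "s \<le> a"
    "(u has_sum x) J"
    using assms(1) unfolding expansion_cost_le_def by blast
  obtain w t where w: "\<And>k. k \<in> J \<Longrightarrow> w k \<in> V k" "((\<lambda>k. norm (w k)) has_sum t) J" "t \<le> b"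
    "(w has_sum y) J"
    using assms(2) unfolding expansion_cost_le_def by blast
  have st: "((\<lambda>k. norm (u k) + norm (w k)) has_sum (s + t)) J"
    by (rule has_sum_add[OF u(2) w(2)])
  have "(\<lambda>k. norm (u k + w k)) summable_on J"
    by (rule summable_on_comparison_test[OF has_sum_imp_summable[OF st]])
      (auto intro: norm_triangle_ineq)
  then obtain q where q: "((\<lambda>k. norm (u k + w k)) has_sum q) J"
    by (auto simp: summable_on_def)
  have "q \<le> s + t" by (rule has_sum_mono[OF q st]) (rule norm_triangle_ineq)
  then show ?thesis
    unfolding expansion_cost_le_def
    using q u w has_sum_add[OF u(4) w(4)] subspace_add[OF sub]
    by (intro exI[of _ "\<lambda>k. u k + w k"] exI[of _ q]) auto
qed

lemma expansion_cost_le_scale: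
  assumes "expansion_cost_le J V x a"
  shows "expansion_cost_le J V (smul c x) (norm c * a)"
proof -
  obtain u s where u: "\<And>k. k \<in> J \<Longrightarrow> u k \<in> V k" "((\<lambda>k. norm (u k)) has_sum s) J" "s \<le> a"
    "(u has_sum x) J"
    using assms(1) unfolding expansion_cost_le_def by blast
  have "((\<lambda>k. norm (smul c (u k))) has_sum (norm c * s)) J"
    using has_sum_cmult_right[OF u(2), of "norm c"] by (simp add: norm_scale)
  then show ?thesis
    unfolding expansion_cost_le_def
    using u has_sum_bounded_linear[OF bounded_linear_smul u(4), of c] subspace_scale[OF sub]
    by (intro exI[of _ "\<lambda>k. smul c (u k)"] exI[of _ "norm c * s"])
      (auto intro: mult_left_mono)
qed

end

end

text \<open>Expansions of the terms of a series with summable costs are added up componentwise; this is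
  where closedness of the subspaces is needed.\<close>
lemma expansion_suminf:
  fixes V :: "nat \<Rightarrow> 'a::banach set"
  assumes N: "normed_space_over smul"
    and sub: "\<And>k. k \<in> J \<Longrightarrow> module.subspace smul (V k)" and closed: "\<And>k. k \<in> J \<Longrightarrow> closed (V k)"
    and rep: "\<And>n. expansion_cost_le J V (x n) (a n)" and a: "summable a" and x: "x sums s"
  shows "\<exists>b. expansion_cost_le J V s b"
proof -
  interpret normed_space_over smul by (rule N)
  have "\<exists>u t. (\<forall>k\<in>J. u k \<in> V k) \<and> ((\<lambda>k. norm (u k)) has_sum t) J \<and> t \<le> a n \<and> (u has_sum x n) J" for n
    using rep[of n] unfolding expansion_cost_le_def .
  then obtain u t where u: "\<And>n k. k \<in> J \<Longrightarrow> u n k \<in> V k"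
    and t: "\<And>n. ((\<lambda>k. norm (u n k)) has_sum t n) J" "\<And>n. t n \<le> a n"
    and ux: "\<And>n. (u n has_sum x n) J"
    by metis
  have t0: "0 \<le> t n" for n using t(1) by (rule has_sum_nonneg) simp
  have "summable t"
    by (rule summable_comparison_test'[OF a, of 0]) (simp add: t(2) t0)
  then have "t summable_on UNIV"
    using t0 by (simp add: summable_on_UNIV_nonneg_real_iff)
  then have "(\<lambda>(n, k). norm (u n k)) summable_on (UNIV \<times> J)"
    by (rule summable_on_SigmaI[rotated]) (use t(1) in auto)
  then have abs: "(\<lambda>(k, n). norm (u n k)) summable_on (J \<times> UNIV)"
    using summable_on_swap[of "\<lambda>(n, k). norm (u n k)" UNIV J] by (simp add: case_prod_unfold)
  then have abs': "(\<lambda>p. norm ((\<lambda>(k, n). u n k) p)) summable_on (J \<times> UNIV)"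
    by (simp add: case_prod_unfold)
  have sm: "(\<lambda>(k, n). u n k) summable_on (J \<times> UNIV)"
    by (rule abs_summable_summable[OF abs'])
  then have "(\<lambda>(n, k). u n k) summable_on (UNIV \<times> J)"
    using summable_on_swap[of "\<lambda>(k, n). u n k" J UNIV] by (simp add: case_prod_unfold)
  moreover have "summable (\<lambda>n. norm (x n))"
    by (rule summable_comparison_test'[OF a, of 0]) (simp add: expansion_cost_le_norm[OF rep])
  then have "(x has_sum s) UNIV"
    using x by (rule norm_summable_imp_has_sum)
  ultimately have "((\<lambda>(n, k). u n k) has_sum s) (UNIV \<times> J)"
    by (intro has_sum_SigmaI[where g = x]) (simp_all add: ux)
  then have total: "((\<lambda>(k, n). u n k) has_sum s) (J \<times> UNIV)"
    using has_sum_swap[where f = "\<lambda>(n, k). u n k" and S = s and A = UNIV and B = J] by (simp add: case_prod_unfold)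
  define w where "w k = (\<Sum>\<^sub>\<infinity>n. u n k)" for k
  have absk: "(\<lambda>n. norm (u n k)) summable_on UNIV" if "k \<in> J" for k
    using summable_on_SigmaD1[OF abs that] .
  have w: "((\<lambda>n. u n k) has_sum w k) UNIV" if "k \<in> J" for k
    unfolding w_def using abs_summable_summable[OF absk[OF that]] by (rule has_sum_infsum)
  have "(w has_sum s) J"
    by (rule has_sum_SigmaD[OF total]) (simp add: w)
  moreover have "w k \<in> V k" if k: "k \<in> J" for k
  proof (rule closed_sequentially[OF closed[OF k]])
    show "(\<lambda>m. \<Sum>n<m. u n k) \<longlonglongrightarrow> w k"
      using has_sum_imp_sums[OF w[OF k]] by (simp add: sums_def)
    show "(\<Sum>n<m. u n k) \<in> V k" for m
      using u[OF k] by (intro subspace_sum[OF sub[OF k]])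
  qed
  moreover have "(\<lambda>k. norm (w k)) summable_on J"
  proof (rule summable_on_comparison_test)
    show "(\<lambda>k. \<Sum>\<^sub>\<infinity>n. norm (u n k)) summable_on J"
      using summable_on_SigmaD[OF abs] absk by simp
    show "norm (w k) \<le> (\<Sum>\<^sub>\<infinity>n. norm (u n k))" if "k \<in> J" for k
      unfolding w_def by (rule norm_infsum_bound[OF absk[OF that]])
  qed simp
  ultimately show ?thesis
    unfolding expansion_cost_le_def summable_on_def by blast
qed

context hahn_banach_space
begin

text \<open>The functional \<open>p\<close> below is dominated by \<open>2 C \<parallel>x\<parallel>\<close> and, on each \<open>V k\<close>, by the norm. Therefore
  every functional in the dual that is dominated by \<open>p\<close> has norm at most \<open>C\<close>.\<close>
lemma approximate_expansion:
  fixes J :: "nat set" and V :: "nat \<Rightarrow> 'a set"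
  assumes sub: "\<And>k. k \<in> J \<Longrightarrow> subspace (V k)"
    and C: "C > 0" "\<And>f. f \<in> dual_space smul \<Longrightarrow>
      (\<And>k v. k \<in> J \<Longrightarrow> v \<in> V k \<Longrightarrow> norm (blinfun_apply f v) \<le> norm v) \<Longrightarrow> norm f \<le> C"
  obtains y a where "expansion_cost_le J V y a" "a \<le> 3/2 * C * norm x" "norm (x - y) \<le> 3/4 * norm x"
proof (cases "x = 0")
  case True
  then show ?thesis using that[of 0 0] expansion_cost_le_zero[OF sub] by simp
next
  case False
  define D where "D = {(y, a). expansion_cost_le J V y a}"
  define h :: "'a \<Rightarrow> 'a \<times> real \<Rightarrow> real" where "h = (\<lambda>x (y, a). a + 2 * C * norm (x - y))"
  define p where "p x = (INF d\<in>D. h x d)" for x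
  have D0: "(0, 0) \<in> D" using expansion_cost_le_zero[OF sub] by (simp add: D_def)
  have h_nonneg: "0 \<le> h x d" if "d \<in> D" for x d
    using that C(1)
    by (auto simp: D_def h_def intro!: add_nonneg_nonneg
        intro: order_trans[OF norm_ge_zero expansion_cost_le_norm])
  have p_le: "p x \<le> a + 2 * C * norm (x - y)" if "expansion_cost_le J V y a" for x y a
  proof -
    have "p x \<le> h x (y, a)"
      unfolding p_def using that h_nonneg
      by (intro cINF_lower bdd_belowI2[of _ 0]) (auto simp: D_def)
    then show ?thesis by (simp add: h_def)
  qed
  have p_greatest: "b \<le> p x"
    if "\<And>y a. expansion_cost_le J V y a \<Longrightarrow> b \<le> a + 2 * C * norm (x - y)" for b x
    unfolding p_def using that D0 by (intro cINF_greatest) (auto simp: D_def h_def)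
  have p_nonneg: "0 \<le> p x" for x
    unfolding p_def using D0 h_nonneg by (intro cINF_greatest) auto
  have p_norm: "p x \<le> 2 * C * norm x" for x
    using p_le[OF expansion_cost_le_zero[OF sub]] by simp
  have p_add: "p (x + x') \<le> p x + p x'" for x x'
  proof -
    have "p (x + x') - (a + 2 * C * norm (x - y)) \<le> p x'" if ya: "expansion_cost_le J V y a" for y a
    proof (rule p_greatest)
      fix y' a' assume "expansion_cost_le J V y' a'"
      with ya have "p (x + x') \<le> (a + a') + 2 * C * norm ((x + x') - (y + y'))"
        by (intro p_le expansion_cost_le_add sub)
      also have "norm ((x + x') - (y + y')) \<le> norm (x - y) + norm (x' - y')"
        by (metis add_diff_add norm_triangle_ineq)
      finally show "p (x + x') - (a + 2 * C * norm (x - y)) \<le> a' + 2 * C * norm (x' - y')"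
        using C(1) by (simp add: algebra_simps)
    qed
    then have "p (x + x') - p x' \<le> p x"
      by (intro p_greatest) (simp add: algebra_simps)
    then show ?thesis by simp
  qed
  have scale_le: "p (smul c x) \<le> norm c * p x" if c: "c \<noteq> 0" for c x
  proof -
    have "p (smul c x) / norm c \<le> p x"
    proof (rule p_greatest)
      fix y a assume "expansion_cost_le J V y a"
      then have "p (smul c x) \<le> norm c * a + 2 * C * norm (smul c x - smul c y)"
        by (intro p_le expansion_cost_le_scale sub)
      also have "\<dots> = norm c * (a + 2 * C * norm (x - y))"
        using norm_scale[of c "x - y"] by (simp add: scale_right_diff_distrib distrib_left)
      finally show "p (smul c x) / norm c \<le> a + 2 * C * norm (x - y)"
        using c by (simp add: field_simps)
    qed
    then show ?thesis using c by (simp add: field_simps)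
  qed
  have p_scale: "p (smul c x) = norm c * p x" for c x
  proof (cases "c = 0")
    case True
    then show ?thesis using p_norm[of 0] p_nonneg[of 0] by simp
  next
    case False
    have "p x \<le> norm (inverse c) * p (smul c x)"
      using scale_le[of "inverse c" "smul c x"] False by simp
    then have "norm c * p x \<le> p (smul c x)"
      using False by (simp add: norm_divide field_simps)
    then show ?thesis using scale_le[OF False, of x] by simp
  qed
  obtain f where f: "f \<in> dual_space smul" "\<And>x. norm (blinfun_apply f x) \<le> p x"
    "norm (blinfun_apply f x) = p x"
    using hahn_banach[of p "2 * C" x] p_add p_scale p_norm by blast
  have "norm f \<le> C"
  proof (rule C(2)[OF f(1)])
    fix k v assume "k \<in> J" "v \<in> V k"
    then have "p v \<le> norm v"
      using p_le[OF expansion_cost_le_component[OF sub], of k v v] by simp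
    then show "norm (blinfun_apply f v) \<le> norm v" using f(2) order_trans by blast
  qed
  then have "p x \<le> C * norm x"
    using norm_blinfun[of f x] f(3) by (metis mult_right_mono norm_ge_zero order_trans)
  also have "\<dots> < 3/2 * C * norm x" using False C(1) by simp
  finally have "\<not> 3/2 * C * norm x \<le> p x" by simp
  then obtain y a where ya: "expansion_cost_le J V y a" "a + 2 * C * norm (x - y) < 3/2 * C * norm x"
    using p_greatest[of "3/2 * C * norm x" x] by force
  have "0 \<le> a" using expansion_cost_le_norm[OF ya(1)] norm_ge_zero order_trans by blast
  then have "C * (2 * norm (x - y)) \<le> C * (3/2 * norm x)" using ya(2) by simp
  then have "norm (x - y) \<le> 3/4 * norm x" using C(1) by simp
  moreover have "a \<le> 3/2 * C * norm x" using ya(2) C(1) by (smt (verit) mult_nonneg_nonneg norm_ge_zero)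
  ultimately show ?thesis using that ya(1) by blast
qed

theorem abs_representing_system_if_norming:
  fixes J :: "nat set" and V :: "nat \<Rightarrow> 'a set"
  assumes sub: "\<And>k. k \<in> J \<Longrightarrow> subspace (V k)" and closed: "\<And>k. k \<in> J \<Longrightarrow> closed (V k)"
    and C: "\<And>f. f \<in> dual_space smul \<Longrightarrow>
      (\<And>k v. k \<in> J \<Longrightarrow> v \<in> V k \<Longrightarrow> norm (blinfun_apply f v) \<le> norm v) \<Longrightarrow> norm f \<le> C"
  shows "abs_representing_system smul J V"
proof -
  define B where "B = max C 1"
  have "\<exists>y a. expansion_cost_le J V y a \<and> a \<le> 3/2 * B * norm x \<and> norm (x - y) \<le> 3/4 * norm x" for x
    by (rule approximate_expansion[where J = J and V = V and C = B and x = x])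
      (use C sub in \<open>auto simp: B_def intro: max.coboundedI1\<close>)
  then obtain Y A where YA: "\<And>x. expansion_cost_le J V (Y x) (A x)"
    "\<And>x. A x \<le> 3/2 * B * norm x" "\<And>x. norm (x - Y x) \<le> 3/4 * norm x"
    by metis
  have "\<exists>a. expansion_cost_le J V x a" for x
  proof -
    \<comment> \<open>the remainder after \<open>n\<close> approximation steps\<close>
    define r where "r n = ((\<lambda>z. z - Y z) ^^ n) x" for n
    have r0: "r 0 = x" and rS: "r (Suc n) = r n - Y (r n)" for n by (simp_all add: r_def)
    have r: "norm (r n) \<le> (3/4) ^ n * norm x" for n
    proof (induction n)
      case (Suc n)
      then show ?case using YA(3)[of "r n"] by (simp add: rS)
    qed (simp add: r0)
    have A0: "0 \<le> A z" for z
      using expansion_cost_le_norm[OF YA(1), of z] norm_ge_zero order_trans by blast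
    have A_le: "A (r n) \<le> 3/2 * B * norm x * (3/4) ^ n" for n
    proof -
      have "A (r n) \<le> 3/2 * B * norm (r n)" by (rule YA(2))
      also have "\<dots> \<le> 3/2 * B * ((3/4) ^ n * norm x)"
        using r[of n] by (intro mult_left_mono) (auto simp: B_def)
      finally show ?thesis by (simp add: mult_ac)
    qed
    have "summable (\<lambda>n. A (r n))"
      by (rule summable_comparison_test'[where g = "\<lambda>n. 3/2 * B * norm x * (3/4) ^ n" and N = 0])
        (use A0 A_le in \<open>simp_all add: summable_mult summable_geometric\<close>)
    moreover have "(\<lambda>n. Y (r n)) sums x"
    proof -
      have "(\<Sum>i<n. Y (r i)) = x - r n" for n
        by (induction n) (simp_all add: r0 rS)
      moreover have "r \<longlonglongrightarrow> 0"
      proof (rule Lim_null_comparison)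
        show "\<forall>\<^sub>F n in sequentially. norm (r n) \<le> (3/4) ^ n * norm x" using r by simp
        show "(\<lambda>n. (3/4) ^ n * norm x) \<longlonglongrightarrow> 0"
          by (intro tendsto_mult_left_zero LIMSEQ_power_zero) simp
      qed
      ultimately show ?thesis
        using tendsto_diff[OF tendsto_const, of r 0 sequentially x] by (simp add: sums_def)
    qed
    ultimately show ?thesis
      using YA(1) by (intro expansion_suminf[OF normed_space_over_axioms sub closed])
  qed
  then show ?thesis
    using sub closed by (simp add: abs_representing_system_iff)
qed

end

section \<open>James's distortion argument for \<open>c\<^sub>0\<close>\<close>

text \<open>Linear combinations of \<open>y n, \<dots>, y (m - 1)\<close> with coefficients in the unit ball of the scalars;
  the restriction on \<open>a\<close> outside \<open>{n..<m}\<close> is harmless.\<close>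
definition (in normed_space_over) unit_sums :: "(nat \<Rightarrow> 'a) \<Rightarrow> nat \<Rightarrow> nat \<Rightarrow> 'a set" where
  "unit_sums y n m = {\<Sum>j\<in>{n..<m}. smul (a j) (y j) | a. \<forall>j. norm (a j) \<le> 1}"

context normed_space_over
begin

lemma unit_sums_mem:
  "x \<in> unit_sums y n m \<longleftrightarrow> (\<exists>a. (\<forall>j. norm (a j) \<le> 1) \<and> x = (\<Sum>j\<in>{n..<m}. smul (a j) (y j)))"
  by (auto simp: unit_sums_def)

lemma zero_unit_sums: "0 \<in> unit_sums y n m"
  unfolding unit_sums_mem by (intro exI[of _ "\<lambda>_. 0"]) simp

lemma unit_sums_single: "y n \<in> unit_sums y n (Suc n)"
  unfolding unit_sums_mem by (intro exI[of _ "\<lambda>_. 1"]) simp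

lemma unit_sums_scale:
  assumes "x \<in> unit_sums y n m" "norm c \<le> 1"
  shows "smul c x \<in> unit_sums y n m"
proof -
  obtain a where a: "\<And>j. norm (a j) \<le> 1" "x = (\<Sum>j\<in>{n..<m}. smul (a j) (y j))"
    using assms(1) unfolding unit_sums_mem by blast
  have "norm (c * a j) \<le> 1" for j
    using mult_mono[OF assms(2) a(1), of j] by (simp add: norm_mult)
  then show ?thesis
    unfolding unit_sums_mem a(2) by (intro exI[of _ "\<lambda>j. c * a j"]) (simp add: scale_sum_right)
qed

lemma unit_sums_add:
  assumes "x \<in> unit_sums y n m" "x' \<in> unit_sums y m l" "n \<le> m" "m \<le> l"
  shows "x + x' \<in> unit_sums y n l"
proof -
  obtain a where a: "\<And>j. norm (a j) \<le> 1" "x = (\<Sum>j\<in>{n..<m}. smul (a j) (y j))"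
    using assms(1) unfolding unit_sums_mem by blast
  obtain b where b: "\<And>j. norm (b j) \<le> 1" "x' = (\<Sum>j\<in>{m..<l}. smul (b j) (y j))"
    using assms(2) unfolding unit_sums_mem by blast
  define d where "d j = (if j < m then a j else b j)" for j
  have "(\<Sum>j\<in>{n..<l}. smul (d j) (y j))
      = (\<Sum>j\<in>{n..<m}. smul (d j) (y j)) + (\<Sum>j\<in>{m..<l}. smul (d j) (y j))"
    using assms(3,4) by (simp add: sum.atLeastLessThan_concat)
  also have "\<dots> = x + x'" by (simp add: a(2) b(2) d_def)
  finally show ?thesis
    unfolding unit_sums_mem using a(1) b(1) by (intro exI[of _ d]) (auto simp: d_def)
qed

lemma unit_sums_subspace:
  assumes "subspace S" "\<And>j. y j \<in> S" "x \<in> unit_sums y n m"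
  shows "x \<in> S"
  using assms unfolding unit_sums_mem by (auto intro!: subspace_sum subspace_scale)

text \<open>The suprema \<open>K n\<close> of the norms of unit sums starting at \<open>n\<close> are at least 1; the
  \<open>K\<close> obtained is their infimum, called \<open>L\<close> in the proof.
  The blocks start at an index \<open>n0\<close> where \<open>K n0\<close> is already close to the infimum.\<close>
lemma almost_isometric_blocks:
  assumes norm_ge: "\<And>j. 1 \<le> norm (y j)"
    and bounded: "\<And>n m x. x \<in> unit_sums y n m \<Longrightarrow> norm x \<le> C"
    and \<delta>: "\<delta> > 0"
  obtains K q z where "K > 0" "\<And>i. q i \<le> q (Suc i)" "\<And>i. z i \<in> unit_sums y (q i) (q (Suc i))"
    "\<And>i. K * (1 - \<delta>) \<le> norm (z i)" "\<And>i j x. x \<in> unit_sums y (q i) j \<Longrightarrow> norm x \<le> K * (1 + \<delta>)"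
proof -
  define U where "U n = (\<Union>m\<in>{n..}. unit_sums y n m)" for n
  define K where "K n = (SUP x\<in>U n. norm x)" for n
  have U0: "0 \<in> U n" for n using zero_unit_sums by (auto simp: U_def)
  have bdd: "bdd_above (norm ` U n)" for n
    using bounded by (intro bdd_aboveI2[of _ _ C]) (auto simp: U_def)
  have K_upper: "norm x \<le> K n" if "x \<in> U n" for x n
    unfolding K_def using that bdd by (rule cSUP_upper)
  have K_ge: "1 \<le> K n" for n
  proof -
    have "y n \<in> U n" using unit_sums_single[of y n] by (auto simp: U_def intro!: bexI[of _ "Suc n"])
    then show ?thesis using K_upper norm_ge order_trans by blast
  qed
  define L where "L = (INF n. K n)"
  have L_le: "L \<le> K n" for n
    unfolding L_def using K_ge by (intro cINF_lower bdd_belowI2[of _ 1]) auto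
  have "1 \<le> L"
    unfolding L_def using K_ge by (intro cINF_greatest) auto
  then have L: "L > 0" by simp
  then have "L < L * (1 + \<delta>)" using \<delta> by simp
  then obtain n0 where n0: "K n0 < L * (1 + \<delta>)"
    unfolding L_def using cINF_less_iff[of UNIV K] K_ge
    by (metis UNIV_I UNIV_not_empty bdd_belowI2)
  have next_block: "\<exists>m x. n \<le> m \<and> x \<in> unit_sums y n m \<and> L * (1 - \<delta>) \<le> norm x" for n
  proof -
    have "L * (1 - \<delta>) < L" using L \<delta> by simp
    then have "L * (1 - \<delta>) < K n" using L_le[of n] by simp
    then obtain x where "x \<in> U n" "L * (1 - \<delta>) < norm x"
      unfolding K_def using less_cSUP_iff[OF _ bdd, of n] U0 by blast
    then show ?thesis by (force simp: U_def)
  qed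
  then obtain M Z where MZ: "\<And>n. n \<le> M n" "\<And>n. Z n \<in> unit_sums y n (M n)"
    "\<And>n. L * (1 - \<delta>) \<le> norm (Z n)"
    by metis
  define q where "q i = (M ^^ i) n0" for i
  have qS: "q (Suc i) = M (q i)" for i by (simp add: q_def)
  have n0_le: "n0 \<le> q i" for i
    by (induction i) (auto simp: q_def intro: order_trans[OF _ MZ(1)])
  have upper: "norm x \<le> L * (1 + \<delta>)" if x: "x \<in> unit_sums y (q i) j" for x i j
  proof (cases "q i \<le> j")
    case True
    have "0 + x \<in> unit_sums y n0 j"
      by (rule unit_sums_add[OF zero_unit_sums x n0_le True])
    then have "x \<in> U n0" using True n0_le[of i] by (auto simp: U_def)
    then show ?thesis using K_upper n0 by fastforce
  next
    case False
    then show ?thesis using x L \<delta> by (auto simp: unit_sums_mem)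
  qed
  show ?thesis
    by (rule that[of L q "\<lambda>i. Z (q i)"]) (use L MZ upper in \<open>auto simp: qS\<close>)
qed

end

text \<open>
  Vectors of norm at least \<open>A\<close> all of whose finite unit sums have norm at most \<open>B\<close>. For
  \<open>2 A > B\<close> the map \<open>series\<close> below is an isomorphism of \<open>c\<^sub>0\<close> onto its image.
\<close>
locale c0_basic_sequence = normed_space_over smul
  for smul :: "'k::real_normed_field \<Rightarrow> 'a::banach \<Rightarrow> 'a" +
  fixes z :: "nat \<Rightarrow> 'a" and A B :: real
  assumes lower: "\<And>i. A \<le> norm (z i)"
    and upper: "\<And>n m x. x \<in> unit_sums z n m \<Longrightarrow> norm x \<le> B"
begin

text \<open>Meaningful for coefficient sequences tending to 0, for which the series converges.\<close>
definition series :: "(nat \<Rightarrow> 'k) \<Rightarrow> 'a" where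
  "series b = (\<Sum>i. smul (b i) (z i))"

lemma B_nonneg: "0 \<le> B"
  using upper[OF zero_unit_sums] by simp

lemma norm_partial_sum_le:
  assumes t: "0 \<le> t" and b: "\<And>i. i \<in> {n..<m} \<Longrightarrow> norm (b i) \<le> t"
  shows "norm (\<Sum>i\<in>{n..<m}. smul (b i) (z i)) \<le> B * t"
proof (cases "t = 0")
  case True
  then show ?thesis using b by simp
next
  case False
  define a where "a i = (if i \<in> {n..<m} then b i / of_real t else 0)" for i
  have "norm (a i) \<le> 1" for i
    using b[of i] t False by (simp add: a_def norm_divide)
  then have "norm (\<Sum>i\<in>{n..<m}. smul (a i) (z i)) \<le> B"
    by (intro upper[of _ n m]) (auto simp: unit_sums_mem)
  moreover have "(\<Sum>i\<in>{n..<m}. smul (b i) (z i)) = smul (of_real t) (\<Sum>i\<in>{n..<m}. smul (a i) (z i))"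
    unfolding scale_sum_right using False by (intro sum.cong) (auto simp: a_def)
  ultimately show ?thesis
    using mult_left_mono[OF _ t] t by (simp add: norm_scale mult.commute[of B])
qed

lemma summable_series:
  assumes "b \<longlonglongrightarrow> 0"
  shows "summable (\<lambda>i. smul (b i) (z i))"
  unfolding summable_Cauchy
proof (intro allI impI)
  fix e :: real assume e: "e > 0"
  define t where "t = e / (B + 1)"
  have t: "t > 0" "B * t < e"
    using e B_nonneg by (auto simp: t_def field_simps)
  obtain N where N: "\<And>i. i \<ge> N \<Longrightarrow> norm (b i) < t"
    using LIMSEQ_D[OF assms t(1)] by auto
  have "norm (\<Sum>i\<in>{m..<n}. smul (b i) (z i)) < e" if "m \<ge> N" for m n
  proof -
    have "norm (\<Sum>i\<in>{m..<n}. smul (b i) (z i)) \<le> B * t"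
      using t(1) N that by (intro norm_partial_sum_le) (auto intro: less_imp_le)
    then show ?thesis using t(2) by simp
  qed
  then show "\<exists>N. \<forall>m\<ge>N. \<forall>n. norm (\<Sum>i\<in>{m..<n}. smul (b i) (z i)) < e" by blast
qed

lemma series_add:
  assumes "b \<longlonglongrightarrow> 0" "d \<longlonglongrightarrow> 0"
  shows "series (\<lambda>i. b i + d i) = series b + series d"
  unfolding series_def scale_left_distrib
  using summable_series[OF assms(1)] summable_series[OF assms(2)] by (rule suminf_add[symmetric])

lemma series_scale:
  assumes "b \<longlonglongrightarrow> 0"
  shows "series (\<lambda>i. c * b i) = smul c (series b)"
  unfolding series_def
  using bounded_linear.suminf[OF bounded_linear_smul summable_series[OF assms], of c] by simp

lemma norm_series_le:
  assumes "b \<longlonglongrightarrow> 0" "\<And>i. norm (b i) \<le> t"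
  shows "norm (series b) \<le> B * t"
proof -
  have "0 \<le> t" using assms(2)[of 0] norm_ge_zero order_trans by blast
  then have *: "norm (\<Sum>i<n. smul (b i) (z i)) \<le> B * t" for n
    using norm_partial_sum_le[of t 0 n b] assms(2) by (simp add: lessThan_atLeast0)
  have "(\<lambda>n. \<Sum>i<n. smul (b i) (z i)) \<longlonglongrightarrow> series b"
    using summable_LIMSEQ[OF summable_series[OF assms(1)]] by (simp add: series_def)
  from Lim_bounded[OF tendsto_norm[OF this]] * show ?thesis by blast
qed

text \<open>Changing the sign of every coefficient except the \<open>k\<close>-th gives a vector whose sum with the
  original one is \<open>2 (b k) (z k)\<close>, and whose norm is bounded above.\<close>
lemma norm_series_ge:
  assumes b: "b \<longlonglongrightarrow> 0" "\<And>i. norm (b i) \<le> t"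
  shows "2 * A * norm (b k) - B * t \<le> norm (series b)"
proof -
  define d where "d i = (if i = k then b i else - b i)" for i
  have "(\<lambda>i. norm (d i)) = (\<lambda>i. norm (b i))" by (auto simp: d_def)
  then have d: "d \<longlonglongrightarrow> 0" "\<And>i. norm (d i) \<le> t"
    using b tendsto_norm_zero_iff[of d] tendsto_norm_zero_iff[of b] by (auto simp: fun_eq_iff)
  have "series b + series d = (\<Sum>i. smul (b i + d i) (z i))"
    using series_add[OF b(1) d(1)] by (simp add: series_def)
  also have "\<dots> = (\<Sum>i\<in>{k}. smul (b i + d i) (z i))"
    by (rule suminf_finite) (auto simp: d_def)
  also have "\<dots> = smul (b k + b k) (z k)" by (simp add: d_def)
  also have "\<dots> = smul (2 * b k) (z k)" by (simp only: mult_2)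
  finally have "2 * (norm (b k) * norm (z k)) = norm (series b + series d)"
    by (simp add: norm_scale norm_mult)
  also have "\<dots> \<le> norm (series b) + B * t"
    using norm_triangle_ineq[of "series b" "series d"] norm_series_le[OF d] by simp
  finally show ?thesis
    using mult_left_mono[OF lower[of k], of "norm (b k)"] by (simp add: mult_ac)
qed

lemma series_mem:
  assumes "subspace Y" "closed Y" "\<And>i. z i \<in> Y" "b \<longlonglongrightarrow> 0"
  shows "series b \<in> Y"
proof (rule closed_sequentially[OF assms(2)])
  show "(\<lambda>n. \<Sum>i<n. smul (b i) (z i)) \<longlonglongrightarrow> series b"
    using summable_LIMSEQ[OF summable_series[OF assms(4)]] by (simp add: series_def)
qed (use assms in \<open>auto intro: subspace_sum subspace_scale\<close>)

end

text \<open>In the relative operator norm the vector 0 contributes the value \<open>0 / 0 = 0\<close>.\<close>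
lemma onorm_on_le:
  assumes "0 \<in> F" "0 \<le> B" "\<And>u. u \<in> F \<Longrightarrow> norm (T u) \<le> B * norm u"
  shows "onorm_on F T \<le> B"
  unfolding onorm_on_def
proof (rule cSUP_least)
  fix u assume "u \<in> F"
  then show "norm (T u) / norm u \<le> B"
    using assms by (cases "u = 0") (auto simp: field_simps)
qed (use assms in auto)

lemma onorm_on_nonneg:
  assumes "0 \<in> F" "0 \<le> B" "\<And>u. u \<in> F \<Longrightarrow> norm (T u) \<le> B * norm u"
  shows "0 \<le> onorm_on F T"
proof -
  have "norm (T u) / norm u \<le> B" if "u \<in> F" for u
    using assms that by (cases "u = 0") (auto simp: field_simps)
  then have "norm (T 0) / norm (0 :: 'a) \<le> onorm_on F T"
    unfolding onorm_on_def using assms(1) by (intro cSUP_upper bdd_aboveI2[of _ _ B])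
  then show ?thesis by simp
qed

lemma distortion_le:
  assumes F: "0 \<in> F" and T0: "T 0 = 0" and inj: "inj_on T F" and A: "0 < A" and B: "0 \<le> B"
    and le: "\<And>u. u \<in> F \<Longrightarrow> norm (T u) \<le> B * norm u"
    and ge: "\<And>u. u \<in> F \<Longrightarrow> A * norm u \<le> norm (T u)"
  shows "onorm_on F T * onorm_on (T ` F) (inv_into F T) \<le> B / A"
proof -
  have 0: "0 \<in> T ` F" using F T0 by (metis image_eqI)
  have inv: "norm (inv_into F T v) \<le> 1 / A * norm v" if "v \<in> T ` F" for v
    using that ge inj A by (auto simp: field_simps)
  have "onorm_on F T * onorm_on (T ` F) (inv_into F T) \<le> B * (1 / A)"
    using A B
    by (intro mult_mono onorm_on_le[OF F B le] onorm_on_le[OF 0 _ inv] onorm_on_nonneg[OF 0 _ inv]) auto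
  then show ?thesis by simp
qed

text \<open>Summing along blocks of \<open>y\<close> embeds all of \<open>c\<^sub>0\<close> with distortion at most \<open>1 + \<eta>\<close>, so the
  finite-dimensional subspaces need no separate treatment.\<close>
theorem c0_finitely_representable:
  fixes smul :: "'k::real_normed_field \<Rightarrow> 'a::banach \<Rightarrow> 'a"
  assumes "normed_space_over smul"
    and Y: "module.subspace smul Y" "closed Y" "\<And>j. y j \<in> Y"
    and norm_ge: "\<And>j. 1 \<le> norm (y j)"
    and bounded: "\<And>n m x. x \<in> normed_space_over.unit_sums smul y n m \<Longrightarrow> norm x \<le> C"
  shows "finitely_representable bseq_scale c0_space smul Y"
  unfolding finitely_representable_def
proof (intro allI impI)
  interpret normed_space_over smul by fact
  interpret S: normed_space_over "bseq_scale :: 'k \<Rightarrow> (nat \<Rightarrow>\<^sub>C 'k) \<Rightarrow> _"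
    by (rule normed_space_over_bseq_scale)
  fix F :: "(nat \<Rightarrow>\<^sub>C 'k) set" and \<eta> :: real
  assume "F \<subseteq> c0_space \<and> finite_dim_subspace bseq_scale F \<and> 0 < \<eta>"
  then have Fc0: "F \<subseteq> c0_space" and \<eta>: "\<eta> > 0" and F: "S.subspace F"
    by (auto simp: finite_dim_subspace_def)
  \<comment> \<open>chosen such that the distortion \<open>(1 + \<delta>) / (1 - 3 \<delta>)\<close> equals \<open>1 + \<eta>\<close>\<close>
  define \<delta> where "\<delta> = \<eta> / (4 + 3 * \<eta>)"
  have \<delta>: "\<delta> > 0" "1 - 3 * \<delta> > 0" "(1 + \<delta>) / (1 - 3 * \<delta>) = 1 + \<eta>"
    using \<eta> by (auto simp: \<delta>_def field_simps)
  obtain K q z where K: "K > 0" and q: "\<And>i. q i \<le> q (Suc i)"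
    and z: "\<And>i. z i \<in> unit_sums y (q i) (q (Suc i))" "\<And>i. K * (1 - \<delta>) \<le> norm (z i)"
    and up: "\<And>i j x. x \<in> unit_sums y (q i) j \<Longrightarrow> norm x \<le> K * (1 + \<delta>)"
    using almost_isometric_blocks[of y C \<delta>] norm_ge bounded \<delta>(1) by metis
  interpret c0_basic_sequence smul z "K * (1 - \<delta>)" "K * (1 + \<delta>)"
  proof
    fix n m x assume "x \<in> unit_sums z n m"
    then obtain a where a: "\<And>i. norm (a i) \<le> 1" and x: "x = (\<Sum>i\<in>{n..<m}. smul (a i) (z i))"
      unfolding unit_sums_mem by blast
    have "(\<Sum>i\<in>{n..<n + l}. smul (a i) (z i)) \<in> unit_sums y (q n) (q (n + l))" for l
    proof (induction l)
      case (Suc l)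
      have "q n \<le> q (n + l)" by (rule lift_Suc_mono_le[of q, OF q]) simp
      then show ?case
        using unit_sums_add[OF Suc unit_sums_scale[OF z(1) a]] q by simp
    qed (simp add: zero_unit_sums)
    from this[of "m - n"] show "norm x \<le> K * (1 + \<delta>)"
      using x up[OF zero_unit_sums] by (cases "n \<le> m") (auto intro: up)
  qed (rule z(2))
  define T where "T f = series (apply_bcontfun f)" for f
  have lim: "apply_bcontfun f \<longlonglongrightarrow> 0" if "f \<in> F" for f
    using that Fc0 by (auto simp: c0_space_def)
  have le: "norm (T f) \<le> K * (1 + \<delta>) * norm f" if "f \<in> F" for f
    unfolding T_def by (rule norm_series_le[OF lim[OF that] norm_bounded])
  have ge: "K * (1 - 3 * \<delta>) * norm f \<le> norm (T f)" if "f \<in> F" for f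
  proof -
    have "norm (apply_bcontfun f k)
        \<le> (norm (T f) + K * (1 + \<delta>) * norm f) / (2 * (K * (1 - \<delta>)))" for k
      using norm_series_ge[OF lim[OF that] norm_bounded, of k] K \<delta>
      by (simp add: T_def field_simps)
    then have "norm f \<le> (norm (T f) + K * (1 + \<delta>) * norm f) / (2 * (K * (1 - \<delta>)))"
      by (rule norm_bound)
    moreover have "2 * (K * (1 - \<delta>)) > 0" using K \<delta> by simp
    ultimately have "norm f * (2 * (K * (1 - \<delta>))) \<le> norm (T f) + K * (1 + \<delta>) * norm f"
      by (simp add: pos_le_divide_eq)
    then show ?thesis by (simp add: algebra_simps)
  qed
  have add: "T (f + g) = T f + T g" if "f \<in> F" "g \<in> F" for f g
    using series_add[OF lim[OF that(1)] lim[OF that(2)]] by (simp add: T_def plus_bcontfun.rep_eq)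
  have scale: "T (bseq_scale c f) = smul c (T f)" if "f \<in> F" for c f
  proof -
    have "apply_bcontfun (bseq_scale c f) = (\<lambda>i. c * apply_bcontfun f i)" by auto
    then show ?thesis using series_scale[OF lim[OF that], of c] by (simp add: T_def)
  qed
  have F0: "0 \<in> F" by (rule S.subspace_0[OF F])
  have T0: "T 0 = 0" using scale[OF F0, of 0] by simp
  have inj: "inj_on T F"
  proof (rule inj_onI)
    fix f g assume fg: "f \<in> F" "g \<in> F" "T f = T g"
    have d: "f - g \<in> F" by (rule S.subspace_diff[OF F fg(1,2)])
    have "T f = T (f - g) + T g" using add[OF d fg(2)] by simp
    then have "K * (1 - 3 * \<delta>) * norm (f - g) \<le> 0" using ge[OF d] fg(3) by simp
    then show "f = g" using K \<delta>(2) by (simp add: mult_le_0_iff)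
  qed
  have zY: "z i \<in> Y" for i by (rule unit_sums_subspace[OF Y(1,3) z(1)])
  have "onorm_on F T * onorm_on (T ` F) (inv_into F T) \<le> K * (1 + \<delta>) / (K * (1 - 3 * \<delta>))"
    by (rule distortion_le[OF F0 T0 inj _ _ le ge]) (use K \<delta> in auto)
  also have "\<dots> = 1 + \<eta>" using K \<delta>(3) by simp
  finally have "onorm_on F T * onorm_on (T ` F) (inv_into F T) \<le> 1 + \<eta>" .
  moreover have "T ` F \<subseteq> Y"
    using series_mem[OF Y(1,2) zY lim] by (auto simp: T_def)
  moreover have "linear_map_on bseq_scale smul F T"
    using add scale by (simp add: linear_map_on_def)
  ultimately show "\<exists>T. T ` F \<subseteq> Y \<and> linear_map_on bseq_scale smul F T \<and> inj_on T F \<and>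
      onorm_on F T * onorm_on (T ` F) (inv_into F T) \<le> 1 + \<eta>"
    using inj by blast
qed

section \<open>Omitting finitely many subspaces\<close>

lemma disjoint_blocks:
  fixes P :: "nat \<Rightarrow> nat set \<Rightarrow> bool"
  assumes "\<And>j N. \<exists>I. finite I \<and> (\<forall>k\<in>I. N \<le> k) \<and> P j I"
  shows "\<exists>I. (\<forall>j. P j (I j)) \<and> (\<forall>i j. i \<noteq> j \<longrightarrow> I i \<inter> I j = {})"
proof -
  define I where "I j N = (SOME I. finite I \<and> (\<forall>k\<in>I. N \<le> k) \<and> P j I)" for j N
  define M where "M j N = Suc (Max (insert N (I j N)))" for j N
  have I: "finite (I j N) \<and> (\<forall>k\<in>I j N. N \<le> k) \<and> P j (I j N)" for j N
    unfolding I_def by (rule someI_ex[OF assms])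
  have IM: "N \<le> k \<and> k < M j N" if "k \<in> I j N" for j N k
    using I[of j N] that by (simp add: M_def less_Suc_eq_le)
  have NM: "N \<le> M j N" for j N
    using I[of j N] by (simp add: M_def le_Suc_eq)
  define n where "n = rec_nat 0 M"
  have nS: "n (Suc j) = M j (n j)" for j by (simp add: n_def)
  have mono: "n i \<le> n j" if "i \<le> j" for i j
    using that by (rule lift_Suc_mono_le[of n, rotated]) (simp add: nS NM)
  have "I i (n i) \<inter> I j (n j) = {}" if "i < j" for i j
    using IM[of _ i "n i"] IM[of _ j "n j"] mono[of "Suc i" j] that nS[of i] by fastforce
  then have "I i (n i) \<inter> I j (n j) = {}" if "i \<noteq> j" for i j
    using that by (metis Int_commute nat_neq_iff)
  then show ?thesis using I by (intro exI[of _ "\<lambda>j. I j (n j)"]) auto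
qed

lemma unit_sums_bounded_if_almost_disjoint:
  fixes f :: "nat \<Rightarrow> 'a::banach \<Rightarrow>\<^sub>L 'k::real_normed_field"
  assumes norm1: "\<And>j. norm (f j) = 1"
    and disj: "\<And>i j. i \<noteq> j \<Longrightarrow> I i \<inter> I j = {}"
    and small: "\<And>j k v. k \<in> J \<Longrightarrow> k \<notin> I j \<Longrightarrow> v \<in> V k \<Longrightarrow>
      norm (blinfun_apply (f j) v) \<le> (1/2) ^ Suc j * norm v"
    and C: "\<And>g :: 'a \<Rightarrow>\<^sub>L 'k. (\<And>k v. k \<in> J \<Longrightarrow> v \<in> V k \<Longrightarrow> norm (blinfun_apply g v) \<le> norm v)
      \<Longrightarrow> norm g \<le> C"
    and g: "g \<in> normed_space_over.unit_sums dual_scale f n m"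
  shows "norm g \<le> 2 * C"
proof -
  interpret D: normed_space_over "dual_scale :: 'k \<Rightarrow> ('a \<Rightarrow>\<^sub>L 'k) \<Rightarrow> _"
    by (rule normed_space_over_dual_scale)
  obtain a where a: "\<And>j. norm (a j) \<le> 1" and g_eq: "g = (\<Sum>j\<in>{n..<m}. dual_scale (a j) (f j))"
    using g unfolding D.unit_sums_mem by blast
  have "norm (blinfun_apply ((1/2) *\<^sub>R g) v) \<le> norm v" if kv: "k \<in> J" "v \<in> V k" for k v
  proof -
    \<comment> \<open>\<open>c\<close> vanishes except for at most one index, by disjointness\<close>
    define c where "c j = (if k \<in> I j then 1 else (0::real))" for j
    have term_le: "norm (blinfun_apply (dual_scale (a j) (f j)) v) \<le> (c j + (1/2) ^ Suc j) * norm v" for j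
    proof -
      have "norm (blinfun_apply (f j) v) \<le> (c j + (1/2) ^ Suc j) * norm v"
      proof (cases "k \<in> I j")
        case True
        have "norm (blinfun_apply (f j) v) \<le> 1 * norm v"
          using norm_blinfun[of "f j" v] by (simp add: norm1)
        also have "\<dots> \<le> (c j + (1/2) ^ Suc j) * norm v"
          using True by (intro mult_right_mono) (auto simp: c_def)
        finally show ?thesis .
      qed (use small kv in \<open>simp add: c_def\<close>)
      then show ?thesis
        using mult_mono[OF a[of j], of "norm (blinfun_apply (f j) v)"] by (simp add: norm_mult)
    qed
    have "(\<Sum>j\<in>{n..<m}. c j) = card {j \<in> {n..<m}. k \<in> I j}"
      by (simp add: c_def sum.If_cases Int_def)
    also have "\<dots> \<le> 1"
    proof -
      have "card {j \<in> {n..<m}. k \<in> I j} \<le> Suc 0"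
        unfolding card_le_Suc0_iff_eq[OF finite_subset[of _ "{n..<m}"]] using disj by (auto simp: card_le_Suc0_iff_eq)
      then show ?thesis by simp
    qed
    finally have c: "(\<Sum>j\<in>{n..<m}. c j) \<le> 1" .
    have "(\<Sum>j\<in>{n..<m}. (1/2::real) ^ Suc j) \<le> (\<Sum>j. (1/2) ^ Suc j)"
      using power_half_series by (intro sum_le_suminf) (auto simp: sums_iff)
    also have "\<dots> = 1" using power_half_series by (simp add: sums_iff)
    finally have half: "(\<Sum>j\<in>{n..<m}. (1/2::real) ^ Suc j) \<le> 1" .
    have "norm (blinfun_apply g v) \<le> (\<Sum>j\<in>{n..<m}. (c j + (1/2) ^ Suc j) * norm v)"
      unfolding g_eq blinfun.sum_left using term_le by (rule sum_norm_le)
    also have "\<dots> = ((\<Sum>j\<in>{n..<m}. c j) + (\<Sum>j\<in>{n..<m}. (1/2) ^ Suc j)) * norm v"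
      by (simp only: sum.distrib sum_distrib_right[symmetric])
    also have "\<dots> \<le> 2 * norm v"
      using c half by (intro mult_right_mono) auto
    finally show ?thesis by (simp add: blinfun.scaleR_left)
  qed
  then have "norm ((1/2) *\<^sub>R g) \<le> C" by (rule C)
  then show ?thesis by simp
qed

lemma (in normed_space_over) closed_dual_space: "closed (dual_space smul)"
proof -
  have "dual_space smul = (\<Inter>c. \<Inter>x. {f. blinfun_apply f (smul c x) = c * blinfun_apply f x})"
    by (auto simp: dual_space_def)
  then show ?thesis
    by (auto intro!: closed_INT closed_Collect_eq continuous_intros)
qed

lemma (in hahn_banach_space) almost_vanishing_functional:
  fixes V :: "nat \<Rightarrow> 'a set"
  assumes sub: "\<And>k. k \<in> J \<Longrightarrow> subspace (V k)" and closed: "\<And>k. k \<in> J \<Longrightarrow> closed (V k)"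
    and not_rep: "\<not> abs_representing_system smul J V" and \<epsilon>: "\<epsilon> > 0"
  obtains f where "f \<in> dual_space smul" "norm f = 1"
    "\<And>k v. k \<in> J \<Longrightarrow> v \<in> V k \<Longrightarrow> norm (blinfun_apply f v) \<le> \<epsilon> * norm v"
proof -
  interpret D: normed_space_over "dual_scale :: 'k \<Rightarrow> ('a \<Rightarrow>\<^sub>L 'k) \<Rightarrow> _"
    by (rule normed_space_over_dual_scale)
  have sub': "D.subspace (dual_space smul)"
    by (rule subspace_dual_space) (rule normed_space_over_axioms)
  obtain g where g: "g \<in> dual_space smul" "\<And>k v. k \<in> J \<Longrightarrow> v \<in> V k \<Longrightarrow> norm (blinfun_apply g v) \<le> norm v"
    and large: "\<not> norm g \<le> 1 / \<epsilon>"
    using abs_representing_system_if_norming[where J = J and V = V and C = "1 / \<epsilon>", OF sub closed]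
      not_rep by blast
  have "0 < 1 / \<epsilon>" using \<epsilon> by simp
  with large have g0: "norm g > 0" by linarith
  have inv: "1 / norm g \<le> \<epsilon>" using large \<epsilon> g0 by (simp add: field_simps)
  define f where "f = dual_scale (of_real (1 / norm g)) g"
  have "norm (blinfun_apply f v) \<le> \<epsilon> * norm v" if "k \<in> J" "v \<in> V k" for k v
  proof -
    have "norm (blinfun_apply f v) = 1 / norm g * norm (blinfun_apply g v)"
      by (simp add: f_def norm_mult norm_divide)
    also have "\<dots> \<le> \<epsilon> * norm v"
      using inv g(2)[OF that] \<epsilon> by (intro mult_mono) auto
    finally show ?thesis .
  qed
  moreover have "norm f = 1" using g0 by (simp add: f_def D.norm_scale norm_divide)
  moreover have "f \<in> dual_space smul" unfolding f_def by (rule D.subspace_scale[OF sub' g(1)])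
  ultimately show ?thesis using that by blast
qed

theorem (in hahn_banach_space) abs_representing_system_omit_finite:
  fixes V :: "nat \<Rightarrow> 'a set"
  assumes convex: "C_convex dual_scale (dual_space smul)"
    and rep: "abs_representing_system smul {1..} V"
  shows "\<exists>N0\<ge>1. \<forall>I. finite I \<and> I \<noteq> {} \<and> I \<subseteq> {1..} \<and> Min I \<ge> N0 \<longrightarrow>
    abs_representing_system smul ({1..} - I) V"
proof (rule ccontr)
  assume neg: "\<not> ?thesis"
  have sub: "subspace (V k)" and closed: "closed (V k)" if "k \<in> {1..}" for k
    using rep that by (auto simp: abs_representing_system_def)
  \<comment> \<open>the tolerances \<open>(1/2) ^ Suc j\<close> add up to 1\<close>
  define P where "P j I \<longleftrightarrow> (\<exists>f\<in>dual_space smul. norm f = 1 \<and>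
    (\<forall>k\<in>{1..} - I. \<forall>v\<in>V k. norm (blinfun_apply f v) \<le> (1/2) ^ Suc j * norm v))" for j I
  have blocks: "\<exists>I. finite I \<and> (\<forall>k\<in>I. N \<le> k) \<and> P j I" for j N
  proof -
    obtain I where I: "finite I" "I \<noteq> {}" "Min I \<ge> max N 1"
      and not_rep: "\<not> abs_representing_system smul ({1..} - I) V"
      using neg max.cobounded2[of 1 N] by blast
    obtain f where "f \<in> dual_space smul" "norm f = 1"
      "\<And>k v. k \<in> {1..} - I \<Longrightarrow> v \<in> V k \<Longrightarrow> norm (blinfun_apply f v) \<le> (1/2) ^ Suc j * norm v"
      using almost_vanishing_functional[OF _ _ not_rep, of "(1/2) ^ Suc j"] sub closed by auto
    then have "P j I" unfolding P_def by blast
    moreover have "\<forall>k\<in>I. N \<le> k" using I by auto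
    ultimately show ?thesis using I(1) by blast
  qed
  from disjoint_blocks[of P, OF blocks]
  obtain I where I: "\<And>j. P j (I j)" "\<And>i j. i \<noteq> j \<Longrightarrow> I i \<inter> I j = {}"
    by auto
  from I(1) have "\<forall>j. \<exists>f. f \<in> dual_space smul \<and> norm f = 1 \<and>
      (\<forall>k\<in>{1..} - I j. \<forall>v\<in>V k. norm (blinfun_apply f v) \<le> (1/2) ^ Suc j * norm v)"
    unfolding P_def by blast
  from choice[OF this] obtain f where F: "\<And>j. f j \<in> dual_space smul \<and> norm (f j) = 1 \<and>
      (\<forall>k\<in>{1..} - I j. \<forall>v\<in>V k. norm (blinfun_apply (f j) v) \<le> (1/2) ^ Suc j * norm v)"
    by blast
  have f: "\<And>j. f j \<in> dual_space smul" "\<And>j. norm (f j) = 1"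
    "\<And>j k v. k \<in> {1..} \<Longrightarrow> k \<notin> I j \<Longrightarrow> v \<in> V k \<Longrightarrow>
      norm (blinfun_apply (f j) v) \<le> (1/2) ^ Suc j * norm v"
    using F by (blast, blast, blast)
  have expansion: "\<exists>a. expansion_cost_le {1..} V x a" for x
    using rep by (simp add: abs_representing_system_iff)
  obtain C where "\<forall>g :: 'a \<Rightarrow>\<^sub>L 'k.
      (\<forall>k\<in>{1..}. \<forall>v\<in>V k. norm (blinfun_apply g v) \<le> norm v) \<longrightarrow> norm g \<le> C"
    using norming_constant_exists[OF expansion, where 'b = 'k] ..
  then have C: "norm g \<le> C"
    if "\<And>k v. k \<in> {1..} \<Longrightarrow> v \<in> V k \<Longrightarrow> norm (blinfun_apply g v) \<le> norm v" for g :: "'a \<Rightarrow>\<^sub>L 'k"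
    using that by blast
  have "finitely_representable bseq_scale c0_space dual_scale (dual_space smul)"
  proof (rule c0_finitely_representable)
    show "module.subspace dual_scale (dual_space smul)"
      by (rule subspace_dual_space) (rule normed_space_over_axioms)
    show "norm g \<le> 2 * C" if "g \<in> normed_space_over.unit_sums dual_scale f n m" for n m g
      by (rule unit_sums_bounded_if_almost_disjoint[OF f(2) I(2) f(3) C that])
  qed (use f normed_space_over_dual_scale closed_dual_space in auto)
  then show False using convex by (simp add: C_convex_def)
qed

theorem mainTheorem12:
  fixes V :: "nat \<Rightarrow> 'a::banach set"
  shows
    "(C_convex dual_scale (dual_space (scaleR :: real \<Rightarrow> 'a \<Rightarrow> 'a)) \<longrightarrow>
      abs_representing_system (scaleR :: real \<Rightarrow> 'a \<Rightarrow> 'a) {1..} V \<longrightarrow>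
      (\<exists>N0\<ge>1. \<forall>I. finite I \<and> I \<noteq> {} \<and> I \<subseteq> {1..} \<and> Min I \<ge> N0 \<longrightarrow>
        abs_representing_system (scaleR :: real \<Rightarrow> 'a \<Rightarrow> 'a) ({1..} - I) V))
     \<and>
     (\<forall>scaleC :: complex \<Rightarrow> 'a \<Rightarrow> 'a. normed_space_over scaleC \<longrightarrow>
      C_convex dual_scale (dual_space scaleC) \<longrightarrow>
      abs_representing_system scaleC {1..} V \<longrightarrow>
      (\<exists>N0\<ge>1. \<forall>I. finite I \<and> I \<noteq> {} \<and> I \<subseteq> {1..} \<and> Min I \<ge> N0 \<longrightarrow>
        abs_representing_system scaleC ({1..} - I) V))"
  using hahn_banach_space.abs_representing_system_omit_finite[OF hahn_banach_space_real]
    hahn_banach_space.abs_representing_system_omit_finite[OF hahn_banach_space_complex]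
  by blast

end
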